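(* Let $X$ be a topological space homeomorphic to a $G_\delta$ subset (with the subspace topology) of a locally compact sober space $Y$, i.e. $X$ is LCS-complete. Then every continuous valuation $\nu$ on $X$ extends to a measure $\mu$ on $X$ with its Borel $\sigma$-algebra, i.e. $\mu(U)=\nu(U)$ for every open subset $U$ of $X$.
   Context: A $G_\delta$ subset of a space is an intersection of countably many open subsets. Compactness does not presuppose any separation axiom. A space is locally compact if every point has a neighborhood base of compact saturated sets (saturated = upward closed in the specialization preorder, equivalently intersection of its open neighborhoods); it is sober if every irreducible closed subset is the closure of a unique point. A continuous valuation on a space $X$ is a map $\nu$ from the lattice $\mathcal O X$ of open subsets of $X$ to $[0,\infty]$ that is strict ($\nu(\emptyset)=0$), modular ($\nu(U)+\nu(V)=\nu(U\cup V)+\nu(U\cap V)$), and Scott-continuous (preserves suprema of directed families of open sets). No local finiteness or boundedness is assumed. A measure is a countably additive map from the Borel $\sigma$-algebra to $[0,\infty]$. *)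

theory Defs
  imports "HOL-Analysis.Analysis"
begin

definition spec_le :: "'a topology \<Rightarrow> 'a \<Rightarrow> 'a \<Rightarrow> bool" where
  "spec_le T x y \<longleftrightarrow> x \<in> topspace T \<and> y \<in> topspace T \<and>
     (\<forall>U. openin T U \<and> x \<in> U \<longrightarrow> y \<in> U)"

definition saturated_in :: "'a topology \<Rightarrow> 'a set \<Rightarrow> bool" where
  "saturated_in T S \<longleftrightarrow> S \<subseteq> topspace T \<and> (\<forall>x\<in>S. \<forall>y. spec_le T x y \<longrightarrow> y \<in> S)"

definition loc_compact_space :: "'a topology \<Rightarrow> bool" where
  "loc_compact_space T \<longleftrightarrow>
     (\<forall>x\<in>topspace T. \<forall>U. openin T U \<and> x \<in> U \<longrightarrow>
        (\<exists>K. compactin T K \<and> saturated_in T K \<and> K \<subseteq> U \<and>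
             (\<exists>V. openin T V \<and> x \<in> V \<and> V \<subseteq> K)))"

definition irreducible_closed :: "'a topology \<Rightarrow> 'a set \<Rightarrow> bool" where
  "irreducible_closed T C \<longleftrightarrow> closedin T C \<and> C \<noteq> {} \<and>
     (\<forall>A B. closedin T A \<and> closedin T B \<and> C \<subseteq> A \<union> B \<longrightarrow> C \<subseteq> A \<or> C \<subseteq> B)"

definition sober_space :: "'a topology \<Rightarrow> bool" where
  "sober_space T \<longleftrightarrow>
     (\<forall>C. irreducible_closed T C \<longrightarrow> (\<exists>!x. x \<in> topspace T \<and> C = T closure_of {x}))"

definition Gdelta_subset :: "'a topology \<Rightarrow> 'a set \<Rightarrow> bool" where
  "Gdelta_subset T S \<longleftrightarrow>
     (\<exists>\<U>. countable \<U> \<and> (\<forall>U\<in>\<U>. openin T U) \<and> S = topspace T \<inter> \<Inter>\<U>)"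

definition continuous_valuation :: "'a topology \<Rightarrow> ('a set \<Rightarrow> ennreal) \<Rightarrow> bool" where
  "continuous_valuation T \<nu> \<longleftrightarrow>
     \<nu> {} = 0 \<and>
     (\<forall>U V. openin T U \<and> openin T V \<longrightarrow> \<nu> U + \<nu> V = \<nu> (U \<union> V) + \<nu> (U \<inter> V)) \<and>
     (\<forall>\<D>. \<D> \<noteq> {} \<and> (\<forall>D\<in>\<D>. openin T D) \<and>
           (\<forall>A\<in>\<D>. \<forall>B\<in>\<D>. \<exists>C\<in>\<D>. A \<union> B \<subseteq> C)
        \<longrightarrow> \<nu> (\<Union>\<D>) = (SUP D\<in>\<D>. \<nu> D))"

end

theory Submission
  imports Defs
begin

text \<open>
  A finite valuation extends additively to the algebra of sets whose indicator is an integer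
  combination of indicators of open sets. On a locally compact sober space, every crescent
  \<^term>\<open>U - V\<close> of open sets is approximated in measure by some \<^term>\<open>U' - V\<close> with
  \<^term>\<open>U' \<subseteq> Q\<close> and \<^term>\<open>Q \<subseteq> U\<close>, where \<^term>\<open>Q\<close> is compact saturated; together with well-filteredness
  this gives continuity at the empty set, and the Caratheodory theorem applies. The pushforward
  along an embedding onto a \<open>G\<^sub>\<delta>\<close> set gives measure 0 to the complement of that set, hence the measure
  restricts to it. For an arbitrary valuation \<^term>\<open>\<nu>\<close>, the measures obtained from the truncations
  \<^term>\<open>\<lambda>U. \<nu> (U \<inter> F)\<close> to open sets \<^term>\<open>F\<close> of finite valuation form a directed family. Their supremum is used
  on subsets of the union \<open>L\<close> of all such \<^term>\<open>F\<close>; all other sets can be given measure \<open>\<infinity>\<close>, since an open set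
  not contained in \<open>L\<close> has infinite valuation.
\<close>

section \<open>Extending a modular set function to an algebra\<close>

text \<open>Integer values, so that \<open>represents\<close> can subtract. Repeated entries of the
  list count.\<close>

definition multiplicity_in :: "'a set list \<Rightarrow> 'a \<Rightarrow> int" where
  "multiplicity_in us x = (\<Sum>U\<leftarrow>us. indicator U x)"

lemma multiplicity_in_simps [simp]:
  "multiplicity_in [] x = 0"
  "multiplicity_in (U # us) x = indicator U x + multiplicity_in us x"
  "multiplicity_in (us @ vs) x = multiplicity_in us x + multiplicity_in vs x"
  by (simp_all add: multiplicity_in_def)

lemma multiplicity_in_nonneg: "0 \<le> multiplicity_in us x"
  by (induction us) auto

lemma multiplicity_in_pos_iff: "0 < multiplicity_in us x \<longleftrightarrow> x \<in> \<Union>(set us)"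
proof (induction us)
  case (Cons U us)
  then show ?case using multiplicity_in_nonneg[of us x] by (auto simp: indicator_def)
qed auto

lemma multiplicity_in_eq_0_iff: "multiplicity_in us x = 0 \<longleftrightarrow> x \<notin> \<Union>(set us)"
  using multiplicity_in_pos_iff[of us x] multiplicity_in_nonneg[of us x] by linarith

definition meets :: "'a set list \<Rightarrow> 'a set list \<Rightarrow> 'a set list" where
  "meets us vs = [U \<inter> V. U \<leftarrow> us, V \<leftarrow> vs]"

lemma multiplicity_in_map_Int:
  "multiplicity_in (map ((\<inter>) U) vs) x = indicator U x * multiplicity_in vs x"
  by (induction vs) (auto simp: indicator_def)

lemma multiplicity_in_meets:
  "multiplicity_in (meets us vs) x = multiplicity_in us x * multiplicity_in vs x"
  by (induction us) (auto simp: meets_def multiplicity_in_map_Int algebra_simps)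

text \<open>Insertion sort with union as maximum and intersection as minimum: exchanging
  \<open>U\<close> and \<open>E\<close> for \<open>E \<union> U\<close> and
  \<open>U \<inter> E\<close> keeps the sum of indicators and, by modularity, the sum of the values
  of \<open>r\<close>.\<close>

fun chain_insert :: "'a set \<Rightarrow> 'a set list \<Rightarrow> 'a set list" where
  "chain_insert U [] = [U]"
| "chain_insert U (E # Es) = (E \<union> U) # chain_insert (U \<inter> E) Es"

lemma multiplicity_in_chain_insert:
  "multiplicity_in (chain_insert U Es) x = indicator U x + multiplicity_in Es x"
  by (induction Es arbitrary: U) (auto simp: indicator_def)

lemma Union_chain_insert: "\<Union>(set (chain_insert U Es)) = U \<union> \<Union>(set Es)"
  by (induction Es arbitrary: U) auto

lemma sorted_chain_insert:
  "sorted_wrt (\<supseteq>) Es \<Longrightarrow> sorted_wrt (\<supseteq>) (chain_insert U Es)"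
proof (induction Es arbitrary: U)
  case (Cons E Es)
  have "W \<subseteq> E \<union> U" if "W \<in> set (chain_insert (U \<inter> E) Es)" for W
    using that Union_chain_insert[of "U \<inter> E" Es] Cons.prems by fastforce
  then show ?case using Cons by auto
qed auto

text \<open>Real rather than extended values, so that \<open>ext\<close> can be a difference of
  sums.\<close>

locale modular_valuation =
  fixes T :: "'a topology" and r :: "'a set \<Rightarrow> real"
  assumes r_empty: "r {} = 0"
    and r_modular: "openin T U \<Longrightarrow> openin T V \<Longrightarrow> r U + r V = r (U \<union> V) + r (U \<inter> V)"
    and r_mono: "openin T U \<Longrightarrow> openin T V \<Longrightarrow> U \<subseteq> V \<Longrightarrow> r U \<le> r V"
begin

abbreviation opens :: "'a set set" where "opens \<equiv> {U. openin T U}"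

lemma r_nonneg: "openin T U \<Longrightarrow> 0 \<le> r U"
  using r_mono[of "{}" U] r_empty by simp

lemma chain_insert_open:
  "openin T U \<Longrightarrow> set Es \<subseteq> opens \<Longrightarrow> set (chain_insert U Es) \<subseteq> opens"
  by (induction Es arbitrary: U) auto

lemma sum_chain_insert:
  "openin T U \<Longrightarrow> set Es \<subseteq> opens \<Longrightarrow> sum_list (map r (chain_insert U Es)) = r U + sum_list (map r Es)"
proof (induction Es arbitrary: U)
  case (Cons E Es)
  then have "sum_list (map r (chain_insert (U \<inter> E) Es)) = r (U \<inter> E) + sum_list (map r Es)"
    by (intro Cons.IH) auto
  then show ?case using r_modular[of U E] Cons.prems by (simp add: Un_commute)
qed auto

text \<open>In a decreasing chain the k-th member is the set where the multiplicity is at least k,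
  so a pointwise comparison of multiplicities becomes a comparison member by member.\<close>

lemma sum_chain_mono:
  assumes "set us \<subseteq> opens" "set vs \<subseteq> opens"
    and "sorted_wrt (\<supseteq>) us" "sorted_wrt (\<supseteq>) vs"
    and "\<And>x. multiplicity_in us x \<le> multiplicity_in vs x"
  shows "sum_list (map r us) \<le> sum_list (map r vs)"
  using assms
proof (induction us arbitrary: vs)
  case Nil
  then show ?case by (auto intro!: sum_list_nonneg r_nonneg)
next
  case (Cons U us)
  show ?case
  proof (cases vs)
    case Nil
    have "x \<notin> \<Union>(set (U # us))" for x
      using Cons.prems(5)[of x] multiplicity_in_pos_iff[of "U # us" x] Nil
      by (simp only: multiplicity_in_simps(1)) linarith
    then have "\<forall>W \<in> set (U # us). W = {}" by blast
    then have "sum_list (map r (U # us)) = sum_list (map (\<lambda>_. 0) (U # us))"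
      using r_empty by (intro arg_cong[where f = sum_list] map_cong) auto
    then have "sum_list (map r (U # us)) = 0" by simp
    then show ?thesis using Nil by simp
  next
    case (Cons V vs')
    have sub: "\<Union>(set us) \<subseteq> U" "\<Union>(set vs') \<subseteq> V"
      using Cons.prems(3,4) Cons by auto
    have UV: "U \<subseteq> V"
    proof
      fix x assume "x \<in> U"
      then have "0 < multiplicity_in (U # us) x" by (simp only: multiplicity_in_pos_iff) simp
      then have "0 < multiplicity_in vs x" using Cons.prems(5)[of x] by (rule less_le_trans)
      then have "x \<in> \<Union>(set vs)" by (simp only: multiplicity_in_pos_iff)
      then show "x \<in> V" using sub(2) Cons by auto
    qed
    \<comment> \<open>On \<open>U\<close> both heads contribute 1, which cancels; off
      \<open>U\<close> the decreasing chain \<open>us\<close> contributes nothing.\<close>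
    have le: "multiplicity_in us x \<le> multiplicity_in vs' x" for x
    proof (cases "x \<in> U")
      case True
      then have "x \<in> V" using UV by blast
      then show ?thesis using Cons.prems(5)[of x] True unfolding Cons by simp
    next
      case False
      then have "multiplicity_in us x = 0" using sub(1) by (auto simp: multiplicity_in_eq_0_iff)
      then show ?thesis by (simp add: multiplicity_in_nonneg)
    qed
    have "sum_list (map r us) \<le> sum_list (map r vs')"
      using Cons.prems(1-4) Cons by (intro Cons.IH le) auto
    moreover have "r U \<le> r V" using UV Cons.prems(1,2) Cons by (intro r_mono) auto
    ultimately show ?thesis by (simp add: Cons)
  qed
qed

lemma chain_exists:
  assumes "set us \<subseteq> opens"
  obtains vs where "set vs \<subseteq> opens" "sorted_wrt (\<supseteq>) vs"
    "\<And>x. multiplicity_in vs x = multiplicity_in us x" "sum_list (map r vs) = sum_list (map r us)"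
proof -
  let ?vs = "foldr chain_insert us []"
  have "set ?vs \<subseteq> opens \<and> sorted_wrt (\<supseteq>) ?vs \<and> (\<forall>x. multiplicity_in ?vs x = multiplicity_in us x)
     \<and> sum_list (map r ?vs) = sum_list (map r us)"
    using assms
  proof (induction us)
    case (Cons U us)
    then have U: "openin T U" and IH: "set (foldr chain_insert us []) \<subseteq> opens"
      "sorted_wrt (\<supseteq>) (foldr chain_insert us [])"
      "\<forall>x. multiplicity_in (foldr chain_insert us []) x = multiplicity_in us x"
      "sum_list (map r (foldr chain_insert us [])) = sum_list (map r us)"
      by simp_all
    show ?case
      using chain_insert_open[OF U IH(1)] sorted_chain_insert[OF IH(2)] IH(3,4)
      by (simp add: multiplicity_in_chain_insert sum_chain_insert[OF U IH(1)])
  qed simp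
  then show thesis by (intro that[of ?vs]) simp_all
qed

text \<open>Sorting both families by \<^const>\<open>chain_insert\<close> into decreasing chains, whose members are the
  superlevel sets of the multiplicity function, reduces this to the monotonicity of \<^term>\<open>r\<close>.\<close>

lemma sum_mono_multiplicity:
  assumes "set us \<subseteq> opens" "set vs \<subseteq> opens"
    and "\<And>x. multiplicity_in us x \<le> multiplicity_in vs x"
  shows "sum_list (map r us) \<le> sum_list (map r vs)"
proof -
  obtain us' where us': "set us' \<subseteq> opens" "sorted_wrt (\<supseteq>) us'"
    "\<And>x. multiplicity_in us' x = multiplicity_in us x" "sum_list (map r us') = sum_list (map r us)"
    by (rule chain_exists[OF assms(1)], rule that)
  obtain vs' where vs': "set vs' \<subseteq> opens" "sorted_wrt (\<supseteq>) vs'"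
    "\<And>x. multiplicity_in vs' x = multiplicity_in vs x" "sum_list (map r vs') = sum_list (map r vs)"
    by (rule chain_exists[OF assms(2)], rule that)
  have "sum_list (map r us') \<le> sum_list (map r vs')"
    by (rule sum_chain_mono[OF us'(1) vs'(1) us'(2) vs'(2)]) (simp add: us'(3) vs'(3) assms(3))
  then show ?thesis by (simp add: us' vs')
qed

section \<open>The algebra of represented sets and its additive extension\<close>

definition represents :: "'a set list \<Rightarrow> 'a set list \<Rightarrow> 'a set \<Rightarrow> bool" where
  "represents us vs A \<longleftrightarrow> set us \<subseteq> opens \<and> set vs \<subseteq> opens \<and>
     (\<forall>x. indicator A x = multiplicity_in us x - multiplicity_in vs x)"

lemma representsD:
  assumes "represents us vs A"
  shows "set us \<subseteq> opens" "set vs \<subseteq> opens"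
    and "multiplicity_in us x = multiplicity_in vs x + indicator A x"
  using assms by (auto simp: represents_def)

definition \<A> :: "'a set set" where "\<A> = {A. \<exists>us vs. represents us vs A}"

definition ext :: "'a set \<Rightarrow> real" where
  "ext A = (SOME s. \<exists>us vs. represents us vs A \<and> s = sum_list (map r us) - sum_list (map r vs))"

text \<open>The choice in \<open>ext\<close> does not matter: for two representations, moving the
  negative parts across leaves two sums with the same multiplicity function, which
  \<open>sum_mono_multiplicity\<close> compares in both directions.\<close>

lemma ext_eq:
  assumes "represents us vs A"
  shows "ext A = sum_list (map r us) - sum_list (map r vs)"
proof -
  let ?P = "\<lambda>s. \<exists>us vs. represents us vs A \<and> s = sum_list (map r us) - sum_list (map r vs)"
  have "?P (ext A)"
    unfolding ext_def by (rule someI[of ?P]) (use assms in blast)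
  then obtain us' vs' where *: "represents us' vs' A"
    "ext A = sum_list (map r us') - sum_list (map r vs')" by blast
  have m: "multiplicity_in (us @ vs') x = multiplicity_in (us' @ vs) x" for x
    using representsD(3)[OF assms, of x] representsD(3)[OF *(1), of x] by simp
  have "sum_list (map r (us @ vs')) = sum_list (map r (us' @ vs))"
    using representsD(1,2)[OF assms] representsD(1,2)[OF *(1)]
    by (intro antisym sum_mono_multiplicity eq_refl[OF m] eq_refl[OF m[symmetric]]) auto
  then show ?thesis using *(2) by simp
qed

lemma represents_open: "openin T U \<Longrightarrow> represents [U] [] U"
  by (auto simp: represents_def)

lemma open_in_\<A>: "openin T U \<Longrightarrow> U \<in> \<A>"
  using represents_open by (auto simp: \<A>_def)

lemma ext_open: "openin T U \<Longrightarrow> ext U = r U"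
  by (simp add: ext_eq[OF represents_open])

text \<open>Expand the product of the two differences and collect positive and negative terms;
  \<open>meets\<close> multiplies multiplicities.\<close>

lemma represents_Int:
  assumes "represents us vs A" "represents us' vs' B"
  shows "represents (meets us us' @ meets vs vs') (meets us vs' @ meets vs us') (A \<inter> B)"
  unfolding represents_def
proof (intro conjI allI)
  show "indicator (A \<inter> B) x = multiplicity_in (meets us us' @ meets vs vs') x
      - multiplicity_in (meets us vs' @ meets vs us') x" for x
    by (simp add: multiplicity_in_meets indicator_inter_arith representsD(3)[OF assms(1)]
        representsD(3)[OF assms(2)] algebra_simps)
qed (use representsD(1,2)[OF assms(1)] representsD(1,2)[OF assms(2)] in \<open>auto simp: meets_def\<close>)

lemma represents_Diff:
  assumes "represents us vs A" "represents us' vs' B" "B \<subseteq> A"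
  shows "represents (us @ vs') (vs @ us') (A - B)"
proof -
  have "(indicator (A - B) x :: int) = indicator A x - indicator B x" for x
    using assms(3) by (auto simp: indicator_def)
  then show ?thesis using assms by (auto simp: represents_def)
qed

lemma represents_Un:
  assumes "represents us vs A" "represents us' vs' B" "A \<inter> B = {}"
  shows "represents (us @ us') (vs @ vs') (A \<union> B)"
proof -
  have "(indicator (A \<union> B) x :: int) = indicator A x + indicator B x" for x
    using assms(3) by (auto simp: indicator_def)
  then show ?thesis using assms by (auto simp: represents_def)
qed

lemma \<A>_Int: "A \<in> \<A> \<Longrightarrow> B \<in> \<A> \<Longrightarrow> A \<inter> B \<in> \<A>"
  using represents_Int unfolding \<A>_def by blast

lemma \<A>_Diff: assumes "A \<in> \<A>" "B \<in> \<A>" shows "A - B \<in> \<A>"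
proof -
  have "A - (A \<inter> B) \<in> \<A>"
    using represents_Diff[of _ _ A _ _ "A \<inter> B"] \<A>_Int[OF assms] assms(1) unfolding \<A>_def by blast
  moreover have "A - (A \<inter> B) = A - B" by blast
  ultimately show ?thesis by simp
qed

lemma \<A>_Un: assumes "A \<in> \<A>" "B \<in> \<A>" shows "A \<union> B \<in> \<A>"
proof -
  have "A \<union> (B - A) \<in> \<A>"
    using represents_Un[of _ _ A _ _ "B - A"] \<A>_Diff[OF assms(2,1)] assms(1) unfolding \<A>_def by blast
  then show ?thesis by simp
qed

lemma \<A>_subset: "A \<in> \<A> \<Longrightarrow> A \<subseteq> topspace T"
proof
  fix x assume "A \<in> \<A>" "x \<in> A"
  then obtain us vs where *: "represents us vs A" by (auto simp: \<A>_def)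
  then have "0 < multiplicity_in us x"
    using \<open>x \<in> A\<close> multiplicity_in_nonneg[of vs x] representsD(3)[OF *, of x] by simp
  then obtain U where "U \<in> set us" "x \<in> U" by (auto simp: multiplicity_in_pos_iff)
  then show "x \<in> topspace T" using representsD(1)[OF *] openin_subset by blast
qed

lemma ring_\<A>: "ring_of_sets (topspace T) \<A>"
  unfolding ring_of_sets_iff
  using \<A>_subset \<A>_Un \<A>_Diff open_in_\<A>[OF openin_empty] by auto

lemma ext_Un:
  assumes "A \<in> \<A>" "B \<in> \<A>" "A \<inter> B = {}" shows "ext (A \<union> B) = ext A + ext B"
proof -
  obtain us vs us' vs' where *: "represents us vs A" "represents us' vs' B"
    using assms unfolding \<A>_def by blast
  show ?thesis by (simp add: ext_eq[OF *(1)] ext_eq[OF *(2)] ext_eq[OF represents_Un[OF * assms(3)]])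
qed

lemma ext_nonneg: assumes "A \<in> \<A>" shows "0 \<le> ext A"
proof -
  obtain us vs where *: "represents us vs A" using assms unfolding \<A>_def by blast
  have "multiplicity_in vs x \<le> multiplicity_in us x" for x
    using representsD(3)[OF *, of x] by simp
  then have "sum_list (map r vs) \<le> sum_list (map r us)"
    using representsD(1,2)[OF *] by (intro sum_mono_multiplicity)
  then show ?thesis by (simp add: ext_eq[OF *])
qed

lemma ext_mono: assumes "A \<in> \<A>" "B \<in> \<A>" "A \<subseteq> B" shows "ext A \<le> ext B"
  using ext_Un[OF assms(1) \<A>_Diff[OF assms(2,1)]] ext_nonneg[OF \<A>_Diff[OF assms(2,1)]] assms(3)
  by (simp add: Un_absorb1)

text \<open>Multiplicities depend only on which list members contain the point. Hence a crescent on
  which membership in each set of \<open>F\<close> is constant lies inside \<open>A\<close> or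
  misses it.\<close>

lemma \<A>_finitely_determined:
  assumes "A \<in> \<A>"
  shows "\<exists>F. finite F \<and> F \<subseteq> opens \<and>
    (\<forall>x y. (\<forall>U\<in>F. x \<in> U \<longleftrightarrow> y \<in> U) \<longrightarrow> (x \<in> A \<longleftrightarrow> y \<in> A))"
proof -
  obtain us vs where *: "represents us vs A" using assms unfolding \<A>_def by blast
  have det: "x \<in> A \<longleftrightarrow> y \<in> A" if "\<forall>U\<in>set us \<union> set vs. x \<in> U \<longleftrightarrow> y \<in> U" for x y
  proof -
    have "multiplicity_in ws x = multiplicity_in ws y" if "set ws \<subseteq> set us \<union> set vs" for ws
      unfolding multiplicity_in_def
      using that \<open>\<forall>U\<in>_. _\<close> by (intro arg_cong[where f = sum_list] map_cong) (auto simp: indicator_def)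
    then have "(indicator A x :: int) = indicator A y"
      using representsD(3)[OF *, of x] representsD(3)[OF *, of y] by simp
    then show ?thesis by (cases "x \<in> A"; cases "y \<in> A") simp_all
  qed
  have "set us \<union> set vs \<subseteq> opens" using representsD(1,2)[OF *] by simp
  then show ?thesis using det finite_UnI[OF finite_set finite_set] by blast
qed

end

section \<open>Well-filteredness of sober spaces\<close>

text \<open>Otherwise Zorn's lemma gives an open \<open>M\<close> containing \<open>V\<close>,
  maximal among those that contain no \<open>Q n\<close>. Its complement is irreducible, and the
  generic point of the complement lies in every saturated \<open>Q n\<close>, hence in
  \<open>V\<close>, a contradiction.\<close>

lemma decreasing_compact_subset_open:
  assumes "sober_space Y" and Q: "\<And>n. compactin Y (Q n)" "\<And>n. saturated_in Y (Q n)" "decseq Q"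
    and V: "openin Y V" "(\<Inter>n. Q n) \<subseteq> V"
  shows "\<exists>n::nat. Q n \<subseteq> V"
proof (rule ccontr)
  assume none: "\<not> ?thesis"
  define \<B> where "\<B> = {W. openin Y W \<and> V \<subseteq> W \<and> (\<forall>n. \<not> Q n \<subseteq> W)}"
  have "\<exists>M\<in>\<B>. \<forall>W\<in>\<B>. M \<subseteq> W \<longrightarrow> W = M"
  proof (rule subset_Zorn_nonempty)
    show "\<B> \<noteq> {}" using none V by (auto simp: \<B>_def)
    fix \<C> assume \<C>: "\<C> \<noteq> {}" "subset.chain \<B> \<C>"
    then have sub: "\<C> \<subseteq> \<B>" by (auto simp: subset_chain_def)
    \<comment> \<open>By compactness finitely many members of the chain would cover
      \<open>Q n\<close>, and the largest of them would do so alone.\<close>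
    have "\<not> Q n \<subseteq> \<Union>\<C>" for n
    proof
      assume "Q n \<subseteq> \<Union>\<C>"
      then obtain \<F> where F: "finite \<F>" "\<F> \<subseteq> \<C>" "Q n \<subseteq> \<Union>\<F>"
        using compactinD[OF Q(1)[of n], of \<C>] sub unfolding \<B>_def by blast
      have "\<exists>W\<in>\<C>. Q n \<subseteq> W"
      proof (cases "\<F> = {}")
        case True
        then show ?thesis using F(3) \<C>(1) by auto
      next
        case False
        have "\<forall>X\<in>\<F>. \<forall>Z\<in>\<F>. X \<subseteq> Z \<or> Z \<subseteq> X"
          using \<C>(2) F(2) unfolding subset_chain_def by (meson subsetD)
        then have "subset.chain \<B> \<F>"
          using sub F(2) by (simp add: subset_chain_def)
        then have "\<Union>\<F> \<in> \<F>" using F(1) False by (intro Union_in_chain)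
        then show ?thesis using F(2,3) by blast
      qed
      then show False using sub unfolding \<B>_def by blast
    qed
    moreover have "openin Y (\<Union>\<C>)" using sub by (intro openin_Union) (auto simp: \<B>_def)
    moreover have "V \<subseteq> \<Union>\<C>" using \<C>(1) sub unfolding \<B>_def by blast
    ultimately show "\<Union>\<C> \<in> \<B>" unfolding \<B>_def by simp
  qed
  then obtain M where "M \<in> \<B>" and M_max: "\<forall>W\<in>\<B>. M \<subseteq> W \<longrightarrow> W = M" ..
  then have M: "openin Y M" "V \<subseteq> M" "\<not> Q n \<subseteq> M" for n by (simp_all add: \<B>_def)
  have max: "\<exists>n. Q n \<subseteq> W" if "openin Y W" "M \<subset> W" for W
  proof (rule ccontr)
    assume "\<not> ?thesis"
    then have "W \<in> \<B>" using that M(2) by (auto simp: \<B>_def)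
    then show False using M_max that(2) by blast
  qed
  let ?C = "topspace Y - M"
  have "irreducible_closed Y ?C"
    unfolding irreducible_closed_def
  proof (intro conjI allI impI)
    show "closedin Y ?C" using M(1) by blast
    show "?C \<noteq> {}" using M(3)[of 0] compactin_subset_topspace[OF Q(1)[of 0]] by auto
    fix A B assume *: "closedin Y A \<and> closedin Y B \<and> ?C \<subseteq> A \<union> B"
    show "?C \<subseteq> A \<or> ?C \<subseteq> B"
    proof (rule ccontr)
      assume neg: "\<not> (?C \<subseteq> A \<or> ?C \<subseteq> B)"
      \<comment> \<open>Both enlargements of \<open>M\<close> are strict, so each contains some
        \<open>Q\<close>; a common later \<open>Q\<close> lies in their intersection, which is
        \<open>M\<close> on the space because \<open>A\<close> and \<open>B\<close> cover its
        complement.\<close>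
      have "openin Y (M \<union> (topspace Y - A))" "openin Y (M \<union> (topspace Y - B))"
        using * M(1) by (simp_all add: openin_Un openin_diff)
      moreover have "M \<subset> M \<union> (topspace Y - A)" "M \<subset> M \<union> (topspace Y - B)"
        using neg by blast+
      ultimately obtain m n where mn: "Q m \<subseteq> M \<union> (topspace Y - A)" "Q n \<subseteq> M \<union> (topspace Y - B)"
        using max[of "M \<union> (topspace Y - A)"] max[of "M \<union> (topspace Y - B)"] by blast
      have "Q (max m n) \<subseteq> Q m" "Q (max m n) \<subseteq> Q n"
        using Q(3) by (auto simp: decseq_def)
      then have "Q (max m n) \<subseteq> M" using mn * by blast
      then show False using M(3) by blast
    qed
  qed
  then obtain x where x: "x \<in> topspace Y" "?C = Y closure_of {x}"
    using assms(1) unfolding sober_space_def by (metis (no_types))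
  have "x \<in> Q n" for n
  proof -
    obtain y where y: "y \<in> Q n" "y \<in> ?C"
      using M(3)[of n] compactin_subset_topspace[OF Q(1)[of n]] by blast
    have "spec_le Y y x"
      using y(2) x(1) unfolding x(2) in_closure_of spec_le_def by blast
    then show ?thesis using Q(2)[of n] y(1) unfolding saturated_in_def by blast
  qed
  then have "x \<in> M" using V(2) M(2) by blast
  moreover have "x \<in> ?C" unfolding x(2) using x(1) by (simp add: in_closure_of)
  ultimately show False by blast
qed

lemma compactin_subset_incseq:
  assumes "compactin Y K" "\<And>n::nat. openin Y (V n)" "incseq V" "K \<subseteq> (\<Union>n. V n)"
  shows "\<exists>n. K \<subseteq> V n"
proof -
  obtain \<F> where F: "finite \<F>" "\<F> \<subseteq> range V" "K \<subseteq> \<Union>\<F>"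
    using compactinD[OF assms(1), of "range V"] assms(2,4) by blast
  then obtain I where I: "finite I" "\<F> = V ` I" by (meson finite_subset_image)
  have "V i \<subseteq> V (Max I)" if "i \<in> I" for i
    by (rule incseqD[OF assms(3) Max_ge[OF I(1) that]])
  then show ?thesis using F(3) I(2) by blast
qed

section \<open>Countable additivity\<close>

context modular_valuation
begin

text \<open>For decreasing \<open>A\<close> and \<open>C\<close> in \<open>\<A>\<close>, this says
  that the limit of \<open>ext (C \<inter> A m)\<close> is positive.\<close>

definition heavy :: "(nat \<Rightarrow> 'a set) \<Rightarrow> 'a set \<Rightarrow> bool" where
  "heavy A C \<longleftrightarrow> (\<exists>e>0. \<forall>m. e \<le> ext (C \<inter> A m))"

text \<open>If each part drops below \<open>e / 2\<close> at some index, then at the larger index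
  the whole drops below \<open>e\<close>.\<close>

lemma heavy_split:
  assumes A: "range A \<subseteq> \<A>" "decseq A" and CW: "C \<in> \<A>" "W \<in> \<A>" and "heavy A C"
  shows "heavy A (C \<inter> W) \<or> heavy A (C - W)"
proof (rule ccontr)
  assume neg: "\<not> ?thesis"
  obtain e where e: "e > 0" "\<And>m. e \<le> ext (C \<inter> A m)"
    using \<open>heavy A C\<close> unfolding heavy_def by blast
  have "e / 2 > 0" using e(1) by simp
  then obtain m n where mn: "ext (C \<inter> W \<inter> A m) < e / 2" "ext ((C - W) \<inter> A n) < e / 2"
    using neg unfolding heavy_def by (meson not_le)
  let ?N = "max m n"
  have Am: "A k \<in> \<A>" for k using A(1) by blast
  have sub: "A ?N \<subseteq> A m" "A ?N \<subseteq> A n" using A(2) by (auto simp: decseq_def)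
  have mem: "C \<inter> W \<inter> A k \<in> \<A>" "(C - W) \<inter> A k \<in> \<A>" for k
    using CW Am by (auto intro!: \<A>_Int \<A>_Diff)
  have "ext (C \<inter> A ?N) = ext (C \<inter> W \<inter> A ?N \<union> (C - W) \<inter> A ?N)"
    by (rule arg_cong[where f = ext]) blast
  also have "\<dots> = ext (C \<inter> W \<inter> A ?N) + ext ((C - W) \<inter> A ?N)"
    by (intro ext_Un mem) blast
  also have "\<dots> \<le> ext (C \<inter> W \<inter> A m) + ext ((C - W) \<inter> A n)"
    using sub by (intro add_mono ext_mono mem) blast+
  finally show False using mn e(2)[of ?N] by linarith
qed

text \<open>Cut the crescent by each \<open>W\<close> in \<open>F\<close> in turn and keep a heavy
  part: meeting with \<open>W\<close> shrinks \<open>U'\<close>, removing \<open>W\<close> enlarges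
  \<open>V'\<close>, so the part is again a crescent and \<open>W\<close> contains it or misses
  it.\<close>

lemma heavy_refine:
  assumes A: "range A \<subseteq> \<A>" "decseq A" and UV: "openin T U" "openin T V" "heavy A (U - V)"
    and F: "finite F" "F \<subseteq> opens"
  shows "\<exists>U' V'. openin T U' \<and> openin T V' \<and> U' \<subseteq> U \<and> V \<subseteq> V' \<and> heavy A (U' - V') \<and>
     (\<forall>W\<in>F. U' \<subseteq> W \<or> W \<subseteq> V')"
  using F
proof (induction F)
  case empty
  then show ?case using UV by blast
next
  case (insert W F)
  then obtain U' V' where *: "openin T U'" "openin T V'" "U' \<subseteq> U" "V \<subseteq> V'"
    "heavy A (U' - V')" "\<forall>W\<in>F. U' \<subseteq> W \<or> W \<subseteq> V'" by auto
  have W: "openin T W" using insert.prems by simp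
  have "U' - V' \<in> \<A>" by (intro \<A>_Diff open_in_\<A> *)
  then consider "heavy A ((U' - V') \<inter> W)" | "heavy A (U' - V' - W)"
    using heavy_split[OF A _ open_in_\<A>[OF W] *(5)] by blast
  then show ?case
  proof cases
    case 1
    moreover have "(U' - V') \<inter> W = (U' \<inter> W) - V'" by blast
    ultimately have "heavy A ((U' \<inter> W) - V')" by simp
    moreover have "\<forall>Z\<in>insert W F. U' \<inter> W \<subseteq> Z \<or> Z \<subseteq> V'" using *(6) by blast
    moreover have "openin T (U' \<inter> W)" using * W by blast
    ultimately show ?thesis using *(2-4) by blast
  next
    case 2
    moreover have "U' - V' - W = U' - (V' \<union> W)" by blast
    ultimately have "heavy A (U' - (V' \<union> W))" by simp
    moreover have "\<forall>Z\<in>insert W F. U' \<subseteq> Z \<or> Z \<subseteq> V' \<union> W" using *(6) by blast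
    moreover have "openin T (V' \<union> W)" using * W by blast
    ultimately show ?thesis using *(1,3,4) by blast
  qed
qed

lemma heavy_nonempty:
  assumes "heavy A C" shows "C \<inter> A n \<noteq> {}"
proof
  assume "C \<inter> A n = {}"
  then have "ext (C \<inter> A n) = 0" using ext_open[of "{}"] r_empty by simp
  then show False using assms unfolding heavy_def by (metis not_le)
qed

text \<open>Inner regularity by compact saturated sets, with an open \<open>V\<close> inside
  \<open>Q\<close> because \<open>r\<close> is a valuation on open sets only.\<close>

definition tight :: bool where
  "tight \<longleftrightarrow> (\<forall>U e. openin T U \<and> 0 < e \<longrightarrow> (\<exists>Q V. compactin T Q \<and> saturated_in T Q \<and>
     openin T V \<and> V \<subseteq> Q \<and> Q \<subseteq> U \<and> r U < r V + e))"

lemma heavy_step: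
  assumes A: "range A \<subseteq> \<A>" "decseq A" and UV: "openin T U" "openin T V" "heavy A (U - V)"
    and tight
  shows "\<exists>Q U' V'. compactin T Q \<and> saturated_in T Q \<and> openin T U' \<and> openin T V' \<and>
     U' \<subseteq> Q \<and> Q \<subseteq> U \<and> V \<subseteq> V' \<and> heavy A (U' - V') \<and> Q - V' \<subseteq> A n"
proof -
  have An: "A m \<in> \<A>" for m using A(1) by blast
  obtain F where F: "finite F" "F \<subseteq> opens"
    "\<forall>x y. (\<forall>W\<in>F. x \<in> W \<longleftrightarrow> y \<in> W) \<longrightarrow> (x \<in> A n \<longleftrightarrow> y \<in> A n)"
    using \<A>_finitely_determined[OF An[of n]] by blast
  obtain U1 V1 where 1: "openin T U1" "openin T V1" "U1 \<subseteq> U" "V \<subseteq> V1" "heavy A (U1 - V1)"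
    "\<forall>W\<in>F. U1 \<subseteq> W \<or> W \<subseteq> V1"
    using heavy_refine[OF A UV F(1,2)] by blast
  \<comment> \<open>One point of the refined crescent in \<open>A n\<close> suffices: all its points
    agree with \<open>x\<close> on \<open>F\<close>, so the whole crescent lies in
    \<open>A n\<close>.\<close>
  obtain x where x: "x \<in> U1 - V1" "x \<in> A n" using heavy_nonempty[OF 1(5), of n] by blast
  have sub: "U1 - V1 \<subseteq> A n"
  proof
    fix y assume "y \<in> U1 - V1"
    then have "\<forall>W\<in>F. x \<in> W \<longleftrightarrow> y \<in> W" using 1(6) x(1) by blast
    then show "y \<in> A n" using F(3) x(2) by blast
  qed
  obtain e where e: "e > 0" "\<And>m. e \<le> ext ((U1 - V1) \<inter> A m)"
    using 1(5) unfolding heavy_def by blast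
  \<comment> \<open>Replacing \<open>U1\<close> by \<open>U2\<close> loses less than
    \<open>e / 2\<close>, so at least \<open>e / 2\<close> remains in every
    \<open>A m\<close>.\<close>
  obtain Q U2 where Q: "compactin T Q" "saturated_in T Q" "openin T U2" "U2 \<subseteq> Q" "Q \<subseteq> U1"
    "r U1 < r U2 + e / 2"
    using \<open>tight\<close> 1(1) e(1) unfolding tight_def by (meson half_gt_zero)
  have mem: "U1 \<in> \<A>" "U2 \<in> \<A>" "V1 \<in> \<A>" using 1 Q by (auto intro: open_in_\<A>)
  have "e / 2 \<le> ext ((U2 - V1) \<inter> A m)" for m
  proof -
    have "ext U1 = ext U2 + ext (U1 - U2)"
      using ext_Un[OF mem(2) \<A>_Diff[OF mem(1,2)]] Q(4,5) by (simp add: Un_absorb1)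
    then have small: "ext (U1 - U2) < e / 2" using Q(6) by (simp add: ext_open 1 Q)
    have "e \<le> ext ((U1 - V1) \<inter> A m)" by (rule e(2))
    also have "\<dots> \<le> ext ((U2 - V1) \<inter> A m \<union> (U1 - U2 - (U2 - V1) \<inter> A m))"
      using mem An by (intro ext_mono \<A>_Un \<A>_Int \<A>_Diff) blast+
    also have "\<dots> = ext ((U2 - V1) \<inter> A m) + ext (U1 - U2 - (U2 - V1) \<inter> A m)"
      using mem An by (intro ext_Un \<A>_Int \<A>_Diff) blast+
    also have "ext (U1 - U2 - (U2 - V1) \<inter> A m) \<le> ext (U1 - U2)"
      using mem An by (intro ext_mono \<A>_Int \<A>_Diff) blast+
    finally show ?thesis using small by linarith
  qed
  then have "heavy A (U2 - V1)" unfolding heavy_def using e(1) by (meson half_gt_zero)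
  moreover have "Q - V1 \<subseteq> A n" using sub Q(5) by blast
  ultimately show ?thesis using Q 1 by (meson order_trans)
qed

text \<open>If \<^term>\<open>ext (A n)\<close> stays bounded away from 0, we descend through crescents
  \<^term>\<open>U n - V n\<close> that keep a positive share of every \<^term>\<open>A m\<close>, interposing compact
  saturated sets with \<^term>\<open>U n \<subseteq> Q n\<close>, \<^term>\<open>Q (Suc n) \<subseteq> U n\<close> and \<^term>\<open>Q n - V n \<subseteq> A n\<close>.
  The sets \<^term>\<open>Q n - V n\<close> are not saturated, so well-filteredness does not apply to them. But as
  \<^term>\<open>V\<close> increases, if they had no common point then \<^term>\<open>Q\<close> would decrease into the open set
  \<^term>\<open>\<Union>n. V n\<close>, so that \<^term>\<open>Q n \<subseteq> V n\<close> for large \<^term>\<open>n\<close>.\<close>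

lemma ext_empty_continuous:
  assumes "sober_space T" tight and A: "range A \<subseteq> \<A>" "decseq A" "(\<Inter>n. A n) = {}"
  shows "(\<lambda>n. ext (A n)) \<longlonglongrightarrow> 0"
proof (rule ccontr)
  assume nlim: "\<not> ?thesis"
  have An: "A m \<in> \<A>" for m using A(1) by blast
  have "\<exists>e>0. \<forall>n. e \<le> ext (A n)"
  proof (rule ccontr)
    assume neg: "\<not> ?thesis"
    have "(\<lambda>n. ext (A n)) \<longlonglongrightarrow> 0"
    proof (rule LIMSEQ_I)
      fix e :: real assume "0 < e"
      then obtain N where N: "ext (A N) < e" using neg by (meson not_le)
      have "norm (ext (A n) - 0) < e" if "N \<le> n" for n
        using ext_mono[OF An An decseqD[OF A(2) that]] N ext_nonneg[OF An[of n]] by simp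
      then show "\<exists>N. \<forall>n\<ge>N. norm (ext (A n) - 0) < e" by blast
    qed
    then show False using nlim by simp
  qed
  then have "heavy A (topspace T - {})"
    using \<A>_subset[OF An] unfolding heavy_def by (simp add: Int_absorb1)
  note start = heavy_step[OF A(1,2) openin_topspace openin_empty this \<open>tight\<close>]
  define good where "good n s \<longleftrightarrow> (case s of (Q, U, V) \<Rightarrow> compactin T Q \<and> saturated_in T Q \<and>
    openin T U \<and> openin T V \<and> U \<subseteq> Q \<and> heavy A (U - V) \<and> Q - V \<subseteq> A n)" for n s
  define next_state where "next_state s t \<longleftrightarrow> (case s of (Q, U, V) \<Rightarrow> case t of (Q', U', V') \<Rightarrow>
    Q' \<subseteq> U \<and> V \<subseteq> V')" for s t :: "'a set \<times> 'a set \<times> 'a set"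
  have "\<exists>f. \<forall>n. good n (f n) \<and> next_state (f n) (f (Suc n))"
  proof (rule dependent_nat_choice)
    show "\<exists>s. good 0 s" using start[of 0] unfolding good_def by auto
    fix s n assume "good n s"
    moreover obtain Q U V where s: "s = (Q, U, V)" by (cases s)
    ultimately have "openin T U" "openin T V" "heavy A (U - V)" by (auto simp: good_def)
    from heavy_step[OF A(1,2) this \<open>tight\<close>, of "Suc n"]
    obtain Q' U' V' where "good (Suc n) (Q', U', V')" "next_state s (Q', U', V')"
      unfolding good_def next_state_def s by auto
    then show "\<exists>t. good (Suc n) t \<and> next_state s t" by blast
  qed
  then obtain f where f: "\<And>n. good n (f n)" "\<And>n. next_state (f n) (f (Suc n))" by blast
  define Q U V where "Q n = fst (f n)" and "U n = fst (snd (f n))" and "V n = snd (snd (f n))" for n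
  have Q: "compactin T (Q n)" "saturated_in T (Q n)" and V: "openin T (V n)"
    and UQ: "U n \<subseteq> Q n" and heavy: "heavy A (U n - V n)" and QA: "Q n - V n \<subseteq> A n" for n
    using f(1)[of n] by (auto simp: good_def Q_def U_def V_def split: prod.splits)
  have step: "Q (Suc n) \<subseteq> U n" "V n \<subseteq> V (Suc n)" for n
    using f(2)[of n] by (auto simp: next_state_def Q_def U_def V_def split: prod.splits)
  have mono: "decseq Q" "incseq V"
    using step UQ by (blast intro: decseq_SucI incseq_SucI)+
  have "(\<Inter>n. Q n) \<subseteq> (\<Union>n. V n)"
  proof
    fix x assume x: "x \<in> (\<Inter>n. Q n)"
    show "x \<in> (\<Union>n. V n)"
    proof (rule ccontr)
      assume "x \<notin> (\<Union>n. V n)"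
      then have "x \<in> A n" for n using x by (intro subsetD[OF QA]) simp
      then show False using A(3) by blast
    qed
  qed
  moreover have "openin T (\<Union>n. V n)" using V by (intro openin_Union) auto
  ultimately obtain m where "Q m \<subseteq> (\<Union>n. V n)"
    using decreasing_compact_subset_open[OF assms(1) Q mono(1)] by meson
  then obtain k where k: "Q m \<subseteq> V k"
    using compactin_subset_incseq[OF Q(1) V mono(2)] by blast
  have "Q (max m k) \<subseteq> V (max m k)"
    using k decseqD[OF mono(1), of m "max m k"] incseqD[OF mono(2), of k "max m k"] by auto
  then have "U (max m k) - V (max m k) = {}" using UQ by blast
  then show False using heavy_nonempty[OF heavy[of "max m k"], of 0] by blast
qed

lemma measure_extension:
  assumes "sober_space T" tight
  shows "\<exists>\<mu>. space \<mu> = topspace T \<and> sets \<mu> = sigma_sets (topspace T) opens \<and>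
    (\<forall>U. openin T U \<longrightarrow> emeasure \<mu> U = ennreal (r U))"
proof -
  interpret ring_of_sets "topspace T" \<A> by (rule ring_\<A>)
  have "\<exists>\<mu>. (\<forall>s\<in>\<A>. \<mu> s = ennreal (ext s)) \<and> measure_space (topspace T) (sigma_sets (topspace T) \<A>) \<mu>"
  proof (rule caratheodory_empty_continuous)
    show "positive \<A> (\<lambda>s. ennreal (ext s))"
      using ext_open[of "{}"] r_empty by (simp add: positive_def)
    show "additive \<A> (\<lambda>s. ennreal (ext s))"
      by (simp add: additive_def ext_Un ext_nonneg)
    show "(\<lambda>i. ennreal (ext (A i))) \<longlonglongrightarrow> 0"
      if "range A \<subseteq> \<A>" "decseq A" "(\<Inter>i. A i) = {}" for A
      using tendsto_ennrealI[OF ext_empty_continuous[OF assms that]] by simp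
  qed simp
  then obtain m where m: "\<And>s. s \<in> \<A> \<Longrightarrow> m s = ennreal (ext s)"
    "measure_space (topspace T) (sigma_sets (topspace T) \<A>) m" by blast
  define \<mu> where "\<mu> = measure_of (topspace T) (sigma_sets (topspace T) opens) m"
  have opens: "opens \<subseteq> Pow (topspace T)" using openin_subset by blast
  \<comment> \<open>Caratheodory's measure lives on the sigma-algebra generated by
    \<open>\<A>\<close>; this inclusion lets it be cut down to the Borel sets.\<close>
  have le: "sigma_sets (topspace T) opens \<subseteq> sigma_sets (topspace T) \<A>"
    using open_in_\<A> by (intro sigma_sets_mono') blast
  have "measure_space (topspace T) (sigma_sets (topspace T) opens) m"
    using m(2) le sigma_algebra_sigma_sets[OF opens]
    unfolding measure_space_def positive_def countably_additive_def by blast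
  then have em: "emeasure \<mu> S = m S" if "S \<in> sigma_sets (topspace T) opens" for S
    using that unfolding \<mu>_def measure_space_def
    by (intro emeasure_measure_of_sigma) auto
  have "emeasure \<mu> W = ennreal (r W)" if "openin T W" for W
    using em[of W] m(1)[OF open_in_\<A>[OF that]] that by (simp add: ext_open sigma_sets.Basic)
  moreover have "space \<mu> = topspace T"
    unfolding \<mu>_def using sigma_sets_into_sp[OF opens] by (intro space_measure_of) blast
  moreover have "sets \<mu> = sigma_sets (topspace T) opens"
    unfolding \<mu>_def using sigma_sets_into_sp[OF opens] sigma_sets_sigma_sets_eq[OF opens]
    by (subst sets_measure_of) blast+
  ultimately show ?thesis by blast
qed

end

section \<open>Continuous valuations\<close>

lemma continuous_valuation_modular:
  "continuous_valuation T \<nu> \<Longrightarrow> openin T U \<Longrightarrow> openin T V \<Longrightarrow> \<nu> U + \<nu> V = \<nu> (U \<union> V) + \<nu> (U \<inter> V)"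
  by (simp add: continuous_valuation_def)

lemma continuous_valuation_Union:
  assumes "continuous_valuation T \<nu>" "\<D> \<noteq> {}" "\<And>D. D \<in> \<D> \<Longrightarrow> openin T D"
    and "\<And>A B. A \<in> \<D> \<Longrightarrow> B \<in> \<D> \<Longrightarrow> \<exists>C\<in>\<D>. A \<union> B \<subseteq> C"
  shows "\<nu> (\<Union>\<D>) = (SUP D\<in>\<D>. \<nu> D)"
  using assms unfolding continuous_valuation_def by simp

lemma continuous_valuation_mono:
  assumes "continuous_valuation T \<nu>" "openin T U" "openin T V" "U \<subseteq> V"
  shows "\<nu> U \<le> \<nu> V"
proof -
  have "\<nu> (\<Union>{U, V}) = (SUP D\<in>{U, V}. \<nu> D)"
    using assms by (intro continuous_valuation_Union[OF assms(1)]) auto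
  moreover have "\<Union>{U, V} = V" using assms(4) by auto
  ultimately have "\<nu> V = sup (\<nu> U) (\<nu> V)" by simp
  then show ?thesis by (metis sup_ge1)
qed

text \<open>Pushing forward and truncating to \<open>F\<close> are done together; the total mass
  becomes \<open>\<nu> F\<close>, which is finite in the application.\<close>

lemma continuous_valuation_pushforward:
  assumes \<nu>: "continuous_valuation X \<nu>" and h: "continuous_map X Y h" and F: "openin X F"
  shows "continuous_valuation Y (\<lambda>U. \<nu> ({x \<in> topspace X. h x \<in> U} \<inter> F))"
proof -
  let ?p = "\<lambda>U. {x \<in> topspace X. h x \<in> U} \<inter> F"
  have op: "openin X (?p U)" if "openin Y U" for U
    using openin_continuous_map_preimage[OF h that] F by blast
  show ?thesis
    unfolding continuous_valuation_def
  proof (intro conjI allI impI)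
    show "\<nu> (?p {}) = 0" using \<nu> by (simp add: continuous_valuation_def)
    fix U V assume "openin Y U \<and> openin Y V"
    then have "\<nu> (?p U) + \<nu> (?p V) = \<nu> (?p U \<union> ?p V) + \<nu> (?p U \<inter> ?p V)"
      by (intro continuous_valuation_modular[OF \<nu>] op) auto
    moreover have "?p U \<union> ?p V = ?p (U \<union> V)" "?p U \<inter> ?p V = ?p (U \<inter> V)" by blast+
    ultimately show "\<nu> (?p U) + \<nu> (?p V) = \<nu> (?p (U \<union> V)) + \<nu> (?p (U \<inter> V))" by (simp only:)
  next
    fix \<D> assume \<D>: "\<D> \<noteq> {} \<and> (\<forall>D\<in>\<D>. openin Y D) \<and> (\<forall>A\<in>\<D>. \<forall>B\<in>\<D>. \<exists>C\<in>\<D>. A \<union> B \<subseteq> C)"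
    have "\<nu> (\<Union>(?p ` \<D>)) = (SUP D\<in>?p ` \<D>. \<nu> D)"
    proof (rule continuous_valuation_Union[OF \<nu>])
      show "?p ` \<D> \<noteq> {}" using \<D> by simp
      show "openin X D" if "D \<in> ?p ` \<D>" for D using that \<D> op by auto
      fix A B assume "A \<in> ?p ` \<D>" "B \<in> ?p ` \<D>"
      then obtain A' B' where AB: "A' \<in> \<D>" "A = ?p A'" "B' \<in> \<D>" "B = ?p B'" by (elim imageE)
      then obtain C where "C \<in> \<D>" "A' \<union> B' \<subseteq> C" using \<D> by meson
      then show "\<exists>C\<in>?p ` \<D>. A \<union> B \<subseteq> C" unfolding AB by (intro bexI[of _ "?p C"]) auto
    qed
    moreover have "\<Union>(?p ` \<D>) = ?p (\<Union>\<D>)" by blast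
    ultimately show "\<nu> (?p (\<Union>\<D>)) = (SUP D\<in>\<D>. \<nu> (?p D))" by (simp only: image_image)
  qed
qed

text \<open>By local compactness \<open>U\<close> is the directed union of the open sets that lie in
  some compact saturated subset of \<open>U\<close>; Scott continuity then gives one of almost full
  value.\<close>

lemma finite_valuation_tight:
  assumes \<nu>: "continuous_valuation T \<nu>" and lc: "loc_compact_space T"
    and fin: "\<nu> U < \<infinity>" and U: "openin T U" and e: "0 < (e :: real)"
  shows "\<exists>Q V. compactin T Q \<and> saturated_in T Q \<and> openin T V \<and> V \<subseteq> Q \<and> Q \<subseteq> U \<and>
     enn2real (\<nu> U) < enn2real (\<nu> V) + e"
proof (rule ccontr)
  assume neg: "\<not> ?thesis"
  define \<D> where "\<D> = {V. openin T V \<and> (\<exists>Q. compactin T Q \<and> saturated_in T Q \<and> V \<subseteq> Q \<and> Q \<subseteq> U)}"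
  have empty: "{} \<in> \<D>"
    by (auto simp: \<D>_def saturated_in_def intro!: exI[of _ "{}"])
  have "\<nu> (\<Union>\<D>) = (SUP D\<in>\<D>. \<nu> D)"
  proof (rule continuous_valuation_Union[OF \<nu>])
    show "\<D> \<noteq> {}" using empty by blast
    show "openin T D" if "D \<in> \<D>" for D using that by (simp add: \<D>_def)
    fix A B assume "A \<in> \<D>" "B \<in> \<D>"
    then obtain P Q where *: "openin T A" "compactin T P" "saturated_in T P" "A \<subseteq> P" "P \<subseteq> U"
      "openin T B" "compactin T Q" "saturated_in T Q" "B \<subseteq> Q" "Q \<subseteq> U"
      unfolding \<D>_def by blast
    have "compactin T (P \<union> Q)" using * by (intro compactin_Un)
    moreover have "saturated_in T (P \<union> Q)" using *(3,8) unfolding saturated_in_def by blast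
    moreover have "openin T (A \<union> B)" using * by (intro openin_Un)
    moreover have "A \<union> B \<subseteq> P \<union> Q" "P \<union> Q \<subseteq> U" using * by blast+
    ultimately have "A \<union> B \<in> \<D>" unfolding \<D>_def by blast
    then show "\<exists>C\<in>\<D>. A \<union> B \<subseteq> C" by blast
  qed
  moreover have "\<Union>\<D> = U"
  proof
    show "\<Union>\<D> \<subseteq> U" unfolding \<D>_def by blast
    show "U \<subseteq> \<Union>\<D>"
    proof
      fix x assume "x \<in> U"
      moreover have "x \<in> topspace T" using \<open>x \<in> U\<close> openin_subset[OF U] by blast
      ultimately obtain K V where "compactin T K" "saturated_in T K" "K \<subseteq> U" "openin T V" "x \<in> V" "V \<subseteq> K"
        using lc U unfolding loc_compact_space_def by meson
      then have "V \<in> \<D>" unfolding \<D>_def by blast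
      then show "x \<in> \<Union>\<D>" using \<open>x \<in> V\<close> by blast
    qed
  qed
  ultimately have eq: "\<nu> U = (SUP D\<in>\<D>. \<nu> D)" by simp
  have small: "enn2real (\<nu> V) \<le> enn2real (\<nu> U) - e" if V: "V \<in> \<D>" for V
  proof -
    obtain Q where "compactin T Q" "saturated_in T Q" "openin T V" "V \<subseteq> Q" "Q \<subseteq> U"
      using V unfolding \<D>_def by blast
    then have "\<not> enn2real (\<nu> U) < enn2real (\<nu> V) + e" using neg by meson
    then show ?thesis by simp
  qed
  have "\<nu> V \<le> ennreal (enn2real (\<nu> U) - e)" if "V \<in> \<D>" for V
  proof -
    have "openin T V" "V \<subseteq> U" using that unfolding \<D>_def by blast+
    then have "\<nu> V < top"
      using le_less_trans[OF continuous_valuation_mono[OF \<nu> _ U]] fin by simp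
    then have "\<nu> V = ennreal (enn2real (\<nu> V))" by simp
    also have "\<dots> \<le> ennreal (enn2real (\<nu> U) - e)" by (rule ennreal_leI[OF small[OF that]])
    finally show ?thesis .
  qed
  then have "\<nu> U \<le> ennreal (enn2real (\<nu> U) - e)" unfolding eq by (rule SUP_least)
  then have "enn2real (\<nu> U) \<le> enn2real (ennreal (enn2real (\<nu> U) - e))"
    by (rule enn2real_mono) simp
  \<comment> \<open>\<open>ennreal\<close> sends negative reals to 0, so the bound must be known to
    be nonnegative; the member \<open>{}\<close> of \<open>\<D>\<close> shows this.\<close>
  moreover have "0 \<le> enn2real (\<nu> U) - e"
    using small[OF empty] by (rule order_trans[OF enn2real_nonneg])
  ultimately show False using e by simp
qed

lemma finite_valuation_extends:
  assumes "loc_compact_space T" "sober_space T"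
    and \<nu>: "continuous_valuation T \<nu>" and fin: "\<nu> (topspace T) < \<infinity>"
  shows "\<exists>\<mu>. space \<mu> = topspace T \<and> sets \<mu> = sigma_sets (topspace T) {U. openin T U} \<and>
    (\<forall>U. openin T U \<longrightarrow> emeasure \<mu> U = \<nu> U)"
proof -
  have finU: "\<nu> U < top" if "openin T U" for U
    using le_less_trans[OF continuous_valuation_mono[OF \<nu> that openin_topspace openin_subset[OF that]] fin]
    by simp
  interpret modular_valuation T "\<lambda>U. enn2real (\<nu> U)"
  proof
    show "enn2real (\<nu> {}) = 0" using \<nu> by (simp add: continuous_valuation_def)
    show "enn2real (\<nu> U) \<le> enn2real (\<nu> V)" if "openin T U" "openin T V" "U \<subseteq> V" for U V
      using continuous_valuation_mono[OF \<nu> that] finU[OF that(2)] by (intro enn2real_mono)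
    fix U V assume UV: "openin T U" "openin T V"
    have "enn2real (\<nu> U + \<nu> V) = enn2real (\<nu> (U \<union> V) + \<nu> (U \<inter> V))"
      by (simp only: continuous_valuation_modular[OF \<nu> UV])
    then show "enn2real (\<nu> U) + enn2real (\<nu> V) = enn2real (\<nu> (U \<union> V)) + enn2real (\<nu> (U \<inter> V))"
      using finU UV by (simp add: enn2real_plus openin_Un openin_Int)
  qed
  have tight
    unfolding tight_def using finite_valuation_tight[OF \<nu> assms(1)] finU
    by (simp add: less_top)
  from measure_extension[OF assms(2) this] show ?thesis using finU by auto
qed

section \<open>Restriction to a G-delta subset\<close>

lemma Gdelta_finite_valuation_extends:
  assumes "loc_compact_space Y" "sober_space Y" "Gdelta_subset Y S"
    and "X homeomorphic_space subtopology Y S"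
    and \<nu>: "continuous_valuation X \<nu>" and F: "openin X F" "\<nu> F < \<infinity>"
  shows "\<exists>\<mu>. space \<mu> = topspace X \<and> sets \<mu> = sigma_sets (topspace X) {U. openin X U} \<and>
    (\<forall>U. openin X U \<longrightarrow> emeasure \<mu> U = \<nu> (U \<inter> F))"
proof -
  obtain \<U> where \<U>: "countable \<U>" "\<And>U. U \<in> \<U> \<Longrightarrow> openin Y U" "S = topspace Y \<inter> \<Inter>\<U>"
    using assms(3) unfolding Gdelta_subset_def by blast
  obtain h g where hg: "homeomorphic_maps X (subtopology Y S) h g"
    using assms(4) unfolding homeomorphic_space_def by blast
  have topS: "topspace (subtopology Y S) = S" using \<U>(3) by auto
  have h: "continuous_map X Y h" "h \<in> topspace X \<rightarrow> S" and g: "continuous_map (subtopology Y S) X g"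
    and gh: "\<And>x. x \<in> topspace X \<Longrightarrow> g (h x) = x"
    using hg by (auto simp: homeomorphic_maps_def continuous_map_in_subtopology)
  have gS: "g \<in> S \<rightarrow> topspace X" using continuous_map_funspace[OF g] topS by simp
  define p where "p U = {x \<in> topspace X. h x \<in> U} \<inter> F" for U
  have cv: "continuous_valuation Y (\<lambda>U. \<nu> (p U))"
    unfolding p_def by (rule continuous_valuation_pushforward[OF \<nu> h(1) F(1)])
  have pF: "p U = F" if "S \<subseteq> U" for U
    using that h(2) openin_subset[OF F(1)] unfolding p_def by blast
  have "S \<subseteq> topspace Y" using \<U>(3) by blast
  then have "\<nu> (p (topspace Y)) < \<infinity>" using pF F(2) by simp
  from finite_valuation_extends[OF assms(1,2) cv this]
  obtain \<mu> where \<mu>: "space \<mu> = topspace Y" "sets \<mu> = sigma_sets (topspace Y) {U. openin Y U}"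
    "\<And>U. openin Y U \<Longrightarrow> emeasure \<mu> U = \<nu> (p U)" by blast
  have opY: "U \<in> sets \<mu>" if "openin Y U" for U using that \<mu>(2) by auto
  \<comment> \<open>As \<open>h\<close> maps into \<open>S\<close>, both \<open>U\<close> and the
    whole space pull back to \<open>F\<close>; their equal mass is finite and can be
    subtracted.\<close>
  have "topspace Y - U \<in> null_sets \<mu>" if "U \<in> \<U>" for U
  proof (rule null_setsI)
    have "S \<subseteq> U" using \<U>(3) that by blast
    have "emeasure \<mu> (topspace Y - U) = emeasure \<mu> (topspace Y) - emeasure \<mu> U"
      using \<U>(2)[OF that] openin_subset[OF \<U>(2)[OF that]] pF[OF \<open>S \<subseteq> U\<close>] F(2)
      by (intro emeasure_Diff opY) (auto simp: \<mu>(3))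
    also have "\<dots> = 0"
      using pF[OF \<open>S \<subseteq> U\<close>] pF[OF \<open>S \<subseteq> topspace Y\<close>] F(2) by (simp add: \<mu>(3) \<U>(2)[OF that])
    finally show "emeasure \<mu> (topspace Y - U) = 0" .
    show "topspace Y - U \<in> sets \<mu>" by (intro sets.Diff opY \<U>(2)[OF that]) simp
  qed
  then have null: "(\<Union>U\<in>\<U>. topspace Y - U) \<in> null_sets \<mu>" by (intro null_sets_UN' \<U>(1))
  have S_eq: "S = topspace Y - (\<Union>U\<in>\<U>. topspace Y - U)" using \<U>(3) by blast
  have S: "S \<in> sets \<mu>" unfolding S_eq by (intro sets.Diff opY openin_topspace null_setsD2[OF null])
  \<comment> \<open>The measure on \<open>Y\<close> is restricted to \<open>S\<close> and carried
    back to \<open>X\<close> by the inverse homeomorphism \<open>g\<close>.\<close>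
  define N where "N = distr (restrict_space \<mu> S) (sigma (topspace X) {U. openin X U}) g"
  have opX: "{U. openin X U} \<subseteq> Pow (topspace X)" using openin_subset by blast
  have pre: "\<exists>W. openin Y W \<and> g -` U \<inter> S = W \<inter> S" if "openin X U" for U
  proof -
    have "openin (subtopology Y S) {y \<in> topspace (subtopology Y S). g y \<in> U}"
      by (rule openin_continuous_map_preimage[OF g that])
    then obtain W where W: "openin Y W" "{y \<in> S. g y \<in> U} = W \<inter> S"
      unfolding topS openin_subtopology by blast
    then show ?thesis by (intro exI[of _ W]) auto
  qed
  have space_r: "space (restrict_space \<mu> S) = S"
    using \<open>S \<subseteq> topspace Y\<close> by (simp add: space_restrict_space \<mu>(1) Int_absorb2)
  have gm: "g \<in> measurable (restrict_space \<mu> S) (sigma (topspace X) {U. openin X U})"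
  proof (rule measurable_measure_of[OF opX])
    show "g \<in> space (restrict_space \<mu> S) \<rightarrow> topspace X" using gS space_r by simp
    fix U assume "U \<in> {U. openin X U}"
    then obtain W where "openin Y W" "g -` U \<inter> S = W \<inter> S" using pre by blast
    then show "g -` U \<inter> space (restrict_space \<mu> S) \<in> sets (restrict_space \<mu> S)"
      using opY S by (simp add: space_r sets_restrict_space_iff)
  qed
  have "emeasure N U = \<nu> (U \<inter> F)" if U: "openin X U" for U
  proof -
    obtain W where W: "openin Y W" "g -` U \<inter> S = W \<inter> S" using pre[OF U] by blast
    have "emeasure N U = emeasure (restrict_space \<mu> S) (W \<inter> S)"
      unfolding N_def using U gm opX by (subst emeasure_distr) (auto simp: space_r W(2))
    also have "\<dots> = emeasure \<mu> (W \<inter> S)" using S by (intro emeasure_restrict_space) auto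
    \<comment> \<open>Removing a null set turns the trace on \<open>S\<close> into the open set
      \<open>W\<close>, where \<open>\<mu>\<close> is known.\<close>
    also have "W \<inter> S = W - (\<Union>U\<in>\<U>. topspace Y - U)" using S_eq openin_subset[OF W(1)] by blast
    also have "emeasure \<mu> \<dots> = \<nu> (p W)"
      using emeasure_Diff_null_set[OF null opY[OF W(1)]] \<mu>(3)[OF W(1)] by simp
    also have "p W = U \<inter> F"
    proof -
      have "h x \<in> W \<longleftrightarrow> x \<in> U" if "x \<in> topspace X" for x
      proof -
        have "h x \<in> S" using h(2) that by blast
        then have "h x \<in> W \<longleftrightarrow> h x \<in> g -` U \<inter> S" unfolding W(2) by simp
        then show ?thesis using gh[OF that] \<open>h x \<in> S\<close> by simp
      qed
      then show ?thesis unfolding p_def using openin_subset[OF F(1)] by blast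
    qed
    finally show ?thesis .
  qed
  moreover have "space N = topspace X" "sets N = sigma_sets (topspace X) {U. openin X U}"
    unfolding N_def using opX by (simp_all add: space_measure_of_conv)
  ultimately show ?thesis by blast
qed

section \<open>Valuations that are not locally finite\<close>

text \<open>Series of nonnegative terms commute with directed suprema; the dominating index
  \<open>k\<close> serves all sets of \<open>\<Sigma>\<close> at once, hence all terms of the
  series.\<close>

lemma directed_SUP_countably_additive:
  fixes m :: "'i \<Rightarrow> 'a measure"
  assumes sets: "\<And>i. i \<in> I \<Longrightarrow> sets (m i) = \<Sigma>"
    and dir: "\<And>i j. i \<in> I \<Longrightarrow> j \<in> I \<Longrightarrow> \<exists>k\<in>I. \<forall>A\<in>\<Sigma>. emeasure (m i) A \<le> emeasure (m k) A \<and>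
      emeasure (m j) A \<le> emeasure (m k) A"
  shows "countably_additive \<Sigma> (\<lambda>A. SUP i\<in>I. emeasure (m i) A)"
  unfolding countably_additive_def
proof (intro allI impI)
  fix A :: "nat \<Rightarrow> 'a set" assume A: "range A \<subseteq> \<Sigma>" "disjoint_family A" "\<Union>(range A) \<in> \<Sigma>"
  have "(\<Sum>n. SUP i\<in>I. emeasure (m i) (A n)) = (SUP i\<in>I. \<Sum>n. emeasure (m i) (A n))"
  proof (rule ennreal_suminf_SUP_eq_directed)
    fix N :: "nat set" and i j assume "i \<in> I" "j \<in> I"
    then show "\<exists>k\<in>I. \<forall>n\<in>N. emeasure (m i) (A n) \<le> emeasure (m k) (A n) \<and>
        emeasure (m j) (A n) \<le> emeasure (m k) (A n)"
      using dir[of i j] A(1) by (meson rangeI subsetD)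
  qed
  also have "\<dots> = (SUP i\<in>I. emeasure (m i) (\<Union>(range A)))"
    using A sets by (intro SUP_cong refl suminf_emeasure) auto
  finally show "(\<Sum>n. SUP i\<in>I. emeasure (m i) (A n)) = (SUP i\<in>I. emeasure (m i) (\<Union>(range A)))" .
qed

text \<open>A union not contained in \<open>L\<close> has a member not contained in
  \<open>L\<close>, so one summand is already infinite. \<open>L\<close> may be any set.\<close>

lemma countably_additive_infinite_outside:
  fixes f :: "'a set \<Rightarrow> ennreal"
  assumes "countably_additive \<Sigma> f"
  shows "countably_additive \<Sigma> (\<lambda>A. if A \<subseteq> L then f A else \<infinity>)"
  unfolding countably_additive_def
proof (intro allI impI)
  fix A :: "nat \<Rightarrow> 'a set" assume A: "range A \<subseteq> \<Sigma>" "disjoint_family A" "\<Union>(range A) \<in> \<Sigma>"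
  show "(\<Sum>n. if A n \<subseteq> L then f (A n) else \<infinity>) = (if \<Union>(range A) \<subseteq> L then f (\<Union>(range A)) else \<infinity>)"
  proof (cases "\<Union>(range A) \<subseteq> L")
    case True
    then have "A n \<subseteq> L" for n by blast
    then show ?thesis using True assms A by (simp add: countably_additive_def)
  next
    case False
    then obtain n where n: "\<not> A n \<subseteq> L" by blast
    have "(\<Sum>n. if A n \<subseteq> L then f (A n) else \<infinity>) \<ge> (\<Sum>k\<in>{n}. if A k \<subseteq> L then f (A k) else \<infinity>)"
      by (intro sum_le_suminf) auto
    then show ?thesis using False n by (simp add: top_unique)
  qed
qed

theorem theorem1:
  fixes X :: "'a topology" and Y :: "'b topology" and S :: "'b set"
    and \<nu> :: "'a set \<Rightarrow> ennreal"
  assumes "loc_compact_space Y" and "sober_space Y"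
    and "Gdelta_subset Y S"
    and "X homeomorphic_space subtopology Y S"
    and "continuous_valuation X \<nu>"
  shows "\<exists>\<mu> :: 'a measure. space \<mu> = topspace X \<and>
           sets \<mu> = sigma_sets (topspace X) {U. openin X U} \<and>
           (\<forall>U. openin X U \<longrightarrow> emeasure \<mu> U = \<nu> U)"
proof -
  note \<nu> = assms(5)
  let ?\<Sigma> = "sigma_sets (topspace X) {U. openin X U}"
  have opX: "{U. openin X U} \<subseteq> Pow (topspace X)" using openin_subset by blast
  define I where "I = {F. openin X F \<and> \<nu> F < \<infinity>}"
  have "\<forall>F\<in>I. \<exists>\<mu>. space \<mu> = topspace X \<and> sets \<mu> = ?\<Sigma> \<and> (\<forall>U. openin X U \<longrightarrow> emeasure \<mu> U = \<nu> (U \<inter> F))"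
    using Gdelta_finite_valuation_extends[OF assms] unfolding I_def by blast
  then obtain m where "\<forall>F\<in>I. space (m F) = topspace X \<and> sets (m F) = ?\<Sigma> \<and>
      (\<forall>U. openin X U \<longrightarrow> emeasure (m F) U = \<nu> (U \<inter> F))"
    by (rule bchoice[THEN exE])
  then have m: "space (m F) = topspace X" "sets (m F) = ?\<Sigma>"
    "openin X U \<Longrightarrow> emeasure (m F) U = \<nu> (U \<inter> F)" if "F \<in> I" for F U using that by blast+
  have restr: "emeasure (m F) A \<le> emeasure (m G) A" if FG: "F \<in> I" "G \<in> I" "F \<subseteq> G" and A: "A \<in> ?\<Sigma>" for F G A
  proof -
    have F: "openin X F" "\<nu> F < \<infinity>" using FG by (auto simp: I_def)
    have FS: "F \<in> sets (m G)" using m(2)[OF FG(2)] F(1) by auto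
    \<comment> \<open>\<open>m F\<close> is \<open>m G\<close> restricted to \<open>F\<close>: both
      have finite mass and agree on the open sets, an intersection-stable generator. Thus
      \<open>m\<close> is monotone in \<open>F\<close>.\<close>
    have "m F = density (m G) (indicator F)"
    proof (rule measure_eqI_generator_eq[where A = "\<lambda>_. topspace X"])
      show "Int_stable {U. openin X U}" by (auto simp: Int_stable_def)
      show "emeasure (m F) U = emeasure (density (m G) (indicator F)) U" if "U \<in> {U. openin X U}" for U
      proof -
        have U: "openin X U" "U \<in> sets (m G)" using that m(2)[OF FG(2)] by auto
        have "emeasure (density (m G) (indicator F)) U = \<nu> (F \<inter> U \<inter> G)"
          using emeasure_restricted[OF FS U(2)] m(3)[OF FG(2) openin_Int[OF F(1) U(1)]] by simp
        also have "F \<inter> U \<inter> G = U \<inter> F" using FG(3) by blast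
        finally show ?thesis using m(3)[OF FG(1) U(1)] by simp
      qed
      show "emeasure (m F) (topspace X) \<noteq> \<infinity>"
        using F openin_subset[OF F(1)] by (simp add: m(3)[OF FG(1)] Int_absorb1)
    qed (use opX m(2) FG in auto)
    then have "emeasure (m F) A = emeasure (m G) (F \<inter> A)"
      using emeasure_restricted[OF FS] A m(2)[OF FG(2)] by simp
    also have "\<dots> \<le> emeasure (m G) A" using A m(2)[OF FG(2)] by (intro emeasure_mono) auto
    finally show ?thesis .
  qed
  have I_Un: "F \<union> G \<in> I" if "F \<in> I" "G \<in> I" for F G
  proof -
    have *: "openin X F" "openin X G" "\<nu> F + \<nu> G < \<infinity>" using that by (auto simp: I_def)
    then have "\<nu> (F \<union> G) \<le> \<nu> F + \<nu> G"
      using continuous_valuation_modular[OF \<nu> *(1,2)] by simp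
    then show ?thesis using * by (auto simp: I_def intro: le_less_trans)
  qed
  have I_empty: "{} \<in> I" using \<nu> by (simp add: I_def continuous_valuation_def)
  define f where "f A = (if A \<subseteq> \<Union>I then SUP F\<in>I. emeasure (m F) A else \<infinity>)" for A
  have "countably_additive ?\<Sigma> f"
    unfolding f_def
  proof (intro countably_additive_infinite_outside directed_SUP_countably_additive)
    fix F G assume "F \<in> I" "G \<in> I"
    then show "\<exists>H\<in>I. \<forall>A\<in>?\<Sigma>. emeasure (m F) A \<le> emeasure (m H) A \<and> emeasure (m G) A \<le> emeasure (m H) A"
      using restr I_Un by (intro bexI[of _ "F \<union> G"]) auto
  qed (rule m(2))
  moreover have "positive ?\<Sigma> f"
  proof -
    have "I \<noteq> {}" using I_empty by blast
    then show ?thesis by (simp add: positive_def f_def)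
  qed
  moreover define \<mu> where "\<mu> = measure_of (topspace X) {U. openin X U} f"
  ultimately have em: "emeasure \<mu> U = f U" if "U \<in> ?\<Sigma>" for U
    using that opX by (intro emeasure_measure_of[of \<mu>]) auto
  have "emeasure \<mu> U = \<nu> U" if U: "openin X U" for U
  proof (cases "U \<subseteq> \<Union>I")
    case True
    \<comment> \<open>\<open>U\<close> is the directed union of its traces on the members of
      \<open>I\<close>, so Scott continuity recovers \<open>\<nu> U\<close> from the
      truncations.\<close>
    have "\<nu> (\<Union>((\<inter>) U ` I)) = (SUP D\<in>(\<inter>) U ` I. \<nu> D)"
    proof (rule continuous_valuation_Union[OF \<nu>])
      show "(\<inter>) U ` I \<noteq> {}" using I_empty by blast
      show "openin X D" if "D \<in> (\<inter>) U ` I" for D using that U by (auto simp: I_def)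
      fix A B assume "A \<in> (\<inter>) U ` I" "B \<in> (\<inter>) U ` I"
      then obtain F G where FG: "F \<in> I" "A = U \<inter> F" "G \<in> I" "B = U \<inter> G" by (elim imageE)
      then show "\<exists>C\<in>(\<inter>) U ` I. A \<union> B \<subseteq> C"
        using I_Un by (intro bexI[of _ "U \<inter> (F \<union> G)"]) auto
    qed
    moreover have "\<Union>((\<inter>) U ` I) = U" using True by blast
    ultimately have "\<nu> U = (SUP F\<in>I. \<nu> (U \<inter> F))" by (simp only: image_image)
    also have "\<dots> = f U" using True m(3)[OF _ U] by (simp add: f_def)
    finally show ?thesis using em U by (simp add: sigma_sets.Basic)
  next
    case False
    \<comment> \<open>An open set of finite value would itself be a member of \<open>I\<close> and
      so lie in its union.\<close>
    then have "U \<notin> I" by blast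
    then have "\<nu> U = \<infinity>" using U by (simp add: I_def less_top[symmetric])
    then show ?thesis using em[of U] U False by (simp add: f_def sigma_sets.Basic)
  qed
  moreover have "space \<mu> = topspace X" "sets \<mu> = ?\<Sigma>"
    unfolding \<mu>_def using opX by (simp_all add: space_measure_of_conv)
  ultimately show ?thesis by blast
qed

end
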